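(* Let $e>2$ be an integer, $\alpha\ge 0$ an integer, and $\beta=2(1+3^e)+3^{2e+2}$, such that (i) $w_3\big((3\alpha+\beta)^\dagger\big)=3$; (ii) $\alpha+3=3^l+s\frac{3^e-1}{2}$ for some integers $0\le l<e$ and $s\ge 0$ with $se\equiv 0\pmod 2$. Let $n=\alpha(1+3^e+3^{2e})+\beta$ and write $(3\alpha+\beta)^\dagger=a_03^0+\cdots+a_{e-1}3^{e-1}$ with $0\le a_i\le 2$. Then $g_{n,3}$ is a permutation polynomial of $\mathbb{F}_{3^e}$ if and only if $\gcd(a_0+a_1x+\cdots+a_{e-1}x^{e-1},\ x^e-1)=x-1$ in $\mathbb{F}_3[x]$.
   Context: For a prime $p$, a power $q$ of $p$ and an integer $n\ge 0$, $g_{n,q}\in\mathbb{F}_p[x]$ is the unique polynomial with $\sum_{a\in\mathbb{F}_q}(x+a)^n=g_{n,q}(x^q-x)$. A permutation polynomial of a finite field $\mathbb{F}$ is a polynomial inducing a bijection of $\mathbb{F}$. $w_3(m)$ denotes the sum of the base-$3$ digits of an integer $m\ge 0$. For $m\in\mathbb{Z}$, $m^\dagger$ denotes the unique integer with $1\le m^\dagger\le 3^e-1$ and $m^\dagger\equiv m\pmod{3^e-1}$. *)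

theory Defs
  imports "Berlekamp_Zassenhaus.Finite_Field"
begin

instance Enum.finite_3 :: prime_card
  by standard (simp add: UNIV_finite_3 numeral_3_eq_3 [symmetric])

type_synonym F3 = "Enum.finite_3 mod_ring"

(* The canonical map from F_p to a finite field; it is a ring homomorphism only if
   CHAR('a) = CARD('p). *)
definition prime_field_emb :: "'p::prime_card mod_ring \<Rightarrow> 'a::finite_field" where
  "prime_field_emb c = of_int (to_int_mod_ring c)"

(* g_poly TYPE('q) n is the polynomial g_{n,q} over F_p, where 'q is the field with q elements.
   The description is unique (and meaningful) if p = CARD('p) is the characteristic of 'q. *)
definition g_poly :: "'q::finite_field itself \<Rightarrow> nat \<Rightarrow> 'p::prime_card mod_ring poly" where
  "g_poly _ n =
     (THE g. (\<Sum>a\<in>UNIV. [:a, 1:] ^ n) =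
             pcompose (map_poly prime_field_emb g) (monom 1 CARD('q) - [:0, 1:] :: 'q poly))"

definition permutation_poly :: "'a::finite_field poly \<Rightarrow> bool" where
  "permutation_poly f \<longleftrightarrow> bij (poly f)"

(* Since m < 3 ^ m, all digits at positions i >= m vanish. *)
definition w3 :: "nat \<Rightarrow> nat" where
  "w3 m = (\<Sum>i<m. m div 3 ^ i mod 3)"

definition dagger :: "nat \<Rightarrow> int \<Rightarrow> nat" where
  "dagger e m = (THE r. 1 \<le> r \<and> r \<le> 3 ^ e - 1 \<and> [int r = m] (mod 3 ^ e - 1))"

end

theory Submission
  imports Defs
begin

text \<open>Adjoin to \<open>F\<close>, the field with \<open>3\<^sup>e\<close> elements, a root \<open>x\<close> of \<open>x\<^sup>3 - x = y\<close>, and let \<open>t\<close> be the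
  trace of \<open>y\<close>; the \<open>e\<close>-th power of Frobenius sends \<open>x\<close> to \<open>x + t\<close>. If \<open>t \<noteq> 0\<close>, then
  \<open>x (x + t) (x + 2 t) = y\<close> collapses \<open>g(y)\<close> to \<open>y\<close> raised to the power \<open>\<alpha> + 3\<close>, which by (ii) is, up
  to a sign depending on \<open>y\<close>, a power of Frobenius; so \<open>g\<close> permutes the elements of nonzero trace. If
  \<open>t = 0\<close>, then \<open>x\<close> lies in \<open>F\<close>, exponents only matter modulo \<open>3\<^sup>e - 1\<close>, and digit sum \<open>3\<close> makes
  \<open>g(y) = - L(x)\<close> with \<open>L\<close> the linearized polynomial with coefficients \<open>a\<^sub>i\<close>. Hence \<open>g\<close> is a
  permutation iff the kernel of \<open>L\<close> is the prime field, and since \<open>L\<close> is a polynomial in Frobenius,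
  this kernel is governed by the gcd with \<open>x\<^sup>e - 1\<close>.\<close>

section \<open>Power sums over prime-field translates in characteristic 3\<close>

text \<open>The recursion, which gives the value of the polynomial \<open>g\<close> of index \<open>n\<close> at \<open>y\<close>, comes from
  \<open>(x + c)\<^sup>3 = (x + c) + (x\<^sup>3 - x)\<close> for \<open>c\<close> in the prime field.\<close>

fun shift_sum :: "nat \<Rightarrow> 'a::comm_ring_1 \<Rightarrow> 'a" where
  "shift_sum 0 y = 0"
| "shift_sum (Suc 0) y = 0"
| "shift_sum (Suc (Suc 0)) y = 2"
| "shift_sum (Suc (Suc (Suc n))) y = shift_sum (Suc n) y + y * shift_sum n y"

lemma CHAR_3_zero:
  assumes "CHAR('a::comm_ring_1) = 3"
  shows "(3::'a) = 0"
  using of_nat_CHAR[where ?'a = 'a] assms by simp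

lemma CHAR_3_cube_add:
  assumes "CHAR('a::comm_ring_1) = 3"
  shows "(x + y :: 'a) ^ 3 = x ^ 3 + y ^ 3"
  by (rule freshmans_dream) (simp_all add: assms)

lemma CHAR_3_two:
  assumes "CHAR('a::comm_ring_1) = 3"
  shows "(2::'a) = - 1"
  using CHAR_3_zero[OF assms] by (simp add: eq_neg_iff_add_eq_0)

lemma CHAR_3_cube_diff:
  assumes "CHAR('a::comm_ring_1) = 3"
  shows "(x - y :: 'a) ^ 3 = x ^ 3 - y ^ 3"
  using CHAR_3_cube_add[OF assms, of "x - y" y] by (simp only: diff_add_cancel eq_diff_eq)

text \<open>These are Newton's identities: \<open>x\<close>, \<open>x + 1\<close>,
  \<open>x + 2\<close> are the roots of \<open>Z ^ 3 = Z + (x ^ 3 - x)\<close>, and their power sums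
  of exponents 0, 1, 2 reduce to the starting values 0, 0, 2.\<close>

lemma shift_sum_eq:
  fixes x :: "'a::comm_ring_1"
  assumes "CHAR('a) = 3"
  shows "x ^ n + (x + 1) ^ n + (x + 2) ^ n = shift_sum n (x ^ 3 - x)"
proof -
  note cube_add = CHAR_3_cube_add[OF assms] and two = CHAR_3_two[OF assms]
  have c: "u ^ Suc (Suc (Suc n)) = u ^ Suc n + (x ^ 3 - x) * u ^ n"
    if "u ^ 3 = u + (x ^ 3 - x)" for u n
  proof -
    have "u ^ Suc (Suc (Suc n)) = u ^ 3 * u ^ n" by (simp add: power3_eq_cube algebra_simps)
    then show ?thesis unfolding that by (simp add: algebra_simps)
  qed
  have 0: "x ^ 3 = x + (x ^ 3 - x)" by simp
  have 1: "(x + 1) ^ 3 = (x + 1) + (x ^ 3 - x)" by (simp add: cube_add)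
  have 2: "(x + 2) ^ 3 = (x + 2) + (x ^ 3 - x)"
    by (simp add: CHAR_3_cube_diff[OF assms] two)
  show ?thesis
  proof (induction n "x ^ 3 - x" rule: shift_sum.induct)
    case 1
    show ?case using CHAR_3_zero[OF assms] by simp
  next
    case 2
    show ?case by (simp add: two)
  next
    case 3
    show ?case by (simp add: two power2_eq_square algebra_simps)
  next
    case (4 n)
    show ?case
      unfolding c[OF 0] c[OF 1] c[OF 2] shift_sum.simps 4[symmetric] by (simp only: algebra_simps)
  qed
qed

text \<open>Only ring operations build \<open>shift_sum\<close> from its argument. This later allows
  \<open>x ^ 3 - x\<close> to be replaced by a constant modulo an Artin--Schreier
  polynomial.\<close>

lemma shift_sum_cong:
  fixes v w :: "'a::field poly"
  assumes "[v = w] (mod m)"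
  shows "[shift_sum n v = shift_sum n w] (mod m)"
  using assms by (induction n v rule: shift_sum.induct) (auto intro!: cong_add cong_mult)

lemma shift_sum_const: "shift_sum n [:y:] = [:shift_sum n y:]"
  by (induction n y rule: shift_sum.induct) (auto simp: numeral_poly)

lemma poly_shift_sum: "poly (shift_sum n p) y = shift_sum n (poly p y)"
  by (induction n p rule: shift_sum.induct) auto

lemma pcompose_shift_sum: "pcompose (shift_sum n p) q = shift_sum n (pcompose p q)"
  by (induction n p rule: shift_sum.induct)
    (auto simp: pcompose_add pcompose_mult numeral_poly pcompose_const)

section \<open>The polynomial \<open>g_poly\<close> for the field with three elements\<close>

lemma UNIV_F3: "(UNIV :: F3 set) = {0, 1, 2}"
proof -
  have "(x::F3) \<in> {0, 1, 2}" for x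
  proof -
    obtain i where "i < CARD(Enum.finite_3)" "x = of_nat i"
      using surj_of_nat_mod_ring[of x] by blast
    then show ?thesis by (auto simp: UNIV_finite_3 less_Suc_eq numeral_3_eq_3)
  qed
  then show ?thesis by blast
qed

lemma CHAR_F3: "CHAR(F3) = 3"
  by (simp add: UNIV_finite_3)

lemma CARD_F3: "CARD(F3) = 3"
  by (simp add: UNIV_finite_3)

lemma prime_field_emb_F3: "(prime_field_emb :: F3 \<Rightarrow> F3) = (\<lambda>c. c)"
  by (auto simp: prime_field_emb_def of_int_of_int_mod_ring)

lemma sum_F3: "(\<Sum>a\<in>UNIV. f a) = f 0 + f 1 + f (2 :: F3)"
proof -
  have "CHAR(F3) = 3" by (fact CHAR_F3)
  then have "\<not> CHAR(F3) dvd 2" by auto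
  then have "(2::F3) \<noteq> 0"
    using of_nat_eq_0_iff_char_dvd[of 2, where ?'a = F3] by auto
  moreover have "(2::F3) \<noteq> 1"
    by (metis add_cancel_right_right one_add_one zero_neq_one)
  ultimately show ?thesis unfolding UNIV_F3 by (simp add: add.assoc)
qed

text \<open>Existence is \<open>shift_sum_eq\<close> applied to the indeterminate. Uniqueness holds
  because composition with the nonconstant polynomial \<open>?q\<close> is injective.\<close>

lemma g_poly_F3: "(g_poly TYPE(F3) n :: F3 poly) = shift_sum n [:0, 1:]"
proof -
  let ?q = "monom 1 CARD(F3) - [:0, 1:] :: F3 poly"
  have q: "?q = [:0, 1:] ^ 3 - [:0, 1:]"
    unfolding CARD_F3 by (simp add: monom_altdef)
  have deg: "degree ?q > 0"
  proof -
    have "coeff ?q 3 \<noteq> 0" unfolding CARD_F3 by (simp add: coeff_pCons numeral_3_eq_3)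
    then have "3 \<le> degree ?q" by (rule le_degree)
    then show ?thesis by simp
  qed
  have "(\<Sum>a\<in>UNIV. [:a, 1:] ^ n) = [:0, 1:] ^ n + ([:0, 1:] + 1) ^ n + ([:0, 1:] + 2 :: F3 poly) ^ n"
    unfolding sum_F3 by (simp add: one_pCons numeral_poly)
  also have "\<dots> = shift_sum n ?q"
    unfolding q by (rule shift_sum_eq) (simp add: CHAR_F3 del: semiring_char_mod_ring)
  finally have S: "(\<Sum>a\<in>UNIV. [:a, 1:] ^ n) = shift_sum n ?q" .
  show ?thesis
    unfolding g_poly_def prime_field_emb_F3 map_poly_idI[OF refl] S
  proof (rule the_equality)
    show "shift_sum n ?q = pcompose (shift_sum n [:0, 1:]) ?q"
      by (simp add: pcompose_shift_sum pcompose_idR pcompose_pCons)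
  next
    fix g assume "shift_sum n ?q = pcompose g ?q"
    then have "pcompose (g - shift_sum n [:0, 1:]) ?q = 0"
      by (simp add: pcompose_diff pcompose_shift_sum pcompose_pCons)
    then show "g = shift_sum n [:0, 1:]" using pcompose_eq_0[OF _ deg] by fastforce
  qed
qed

section \<open>Powers of Frobenius and trace sums\<close>

lemma CHAR_3_frobenius_add:
  assumes "CHAR('a::comm_ring_1) = 3"
  shows "(x + y :: 'a) ^ 3 ^ i = x ^ 3 ^ i + y ^ 3 ^ i"
  by (rule freshmans_dream') (simp_all add: assms)

lemma CHAR_3_frobenius_diff:
  assumes "CHAR('a::comm_ring_1) = 3"
  shows "(x - y :: 'a) ^ 3 ^ i = x ^ 3 ^ i - y ^ 3 ^ i"
  using CHAR_3_frobenius_add[OF assms, of "x - y" y i] by (simp only: diff_add_cancel eq_diff_eq)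

lemma power_3_pow_fixed:
  fixes c :: "'a::comm_ring_1"
  assumes "c ^ 3 = c"
  shows "c ^ 3 ^ i = c"
  by (induction i) (simp_all add: power_mult assms)

lemma frobenius_inj:
  fixes x y :: "'a::field"
  assumes "CHAR('a) = 3" "x ^ 3 ^ i = y ^ 3 ^ i"
  shows "x = y"
  using CHAR_3_frobenius_diff[OF assms(1), of x y i] assms(2) by simp

lemma cube_eq_self_iff:
  fixes c :: "'a::field"
  assumes "CHAR('a) = 3"
  shows "c ^ 3 = c \<longleftrightarrow> c \<in> {0, 1, 2}"
proof -
  have "c ^ 3 - c = c * (c - 1) * (c + 1)" by (simp add: power3_eq_cube algebra_simps)
  moreover have "c + 1 = 0 \<longleftrightarrow> c = 2" by (simp add: CHAR_3_two[OF assms] eq_neg_iff_add_eq_0)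
  ultimately have "c ^ 3 - c = 0 \<longleftrightarrow> c \<in> {0, 1, 2}" by (simp add: disj_assoc)
  then show ?thesis by (simp only: right_minus_eq)
qed

lemma power_cube_commute: "(y ^ 3 ^ i) ^ 3 = (y ^ 3) ^ 3 ^ i" for y :: "'a::monoid_mult"
  by (simp only: power_mult[symmetric] mult.commute[of 3])

text \<open>On the field with \<open>3 ^ e\<close> elements this is the absolute trace. The number
  of terms stays free because the partial sums describe all powers of Frobenius on an
  Artin--Schreier root.\<close>

definition trace_sum :: "nat \<Rightarrow> 'a::comm_ring_1 \<Rightarrow> 'a" where
  "trace_sum e y = (\<Sum>i<e. y ^ 3 ^ i)"

lemma trace_sum_Suc: "trace_sum (Suc e) y = y + trace_sum e (y ^ 3)"
  unfolding trace_sum_def sum.lessThan_Suc_shift by (simp add: power_mult)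

lemma trace_sum_cube:
  assumes "CHAR('a::comm_ring_1) = 3"
  shows "trace_sum e (y :: 'a) ^ 3 = trace_sum e (y ^ 3)"
proof -
  have "trace_sum e y ^ 3 = (\<Sum>i<e. (y ^ 3 ^ i) ^ 3)"
    unfolding trace_sum_def by (rule freshmans_dream_sum) (simp_all add: assms)
  also have "\<dots> = trace_sum e (y ^ 3)"
    unfolding trace_sum_def by (simp only: power_cube_commute)
  finally show ?thesis .
qed

lemma trace_sum_add:
  assumes "CHAR('a::comm_ring_1) = 3"
  shows "trace_sum e (x + y :: 'a) = trace_sum e x + trace_sum e y"
  by (simp add: trace_sum_def CHAR_3_frobenius_add[OF assms] sum.distrib)

lemma trace_sum_frobenius:
  assumes "CHAR('a::comm_ring_1) = 3"
  shows "trace_sum e ((y :: 'a) ^ 3 ^ i) = trace_sum e y ^ 3 ^ i"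
  by (induction i arbitrary: y) (simp_all add: power_mult trace_sum_cube[OF assms])

section \<open>Artin--Schreier roots and the values of \<open>g\<close> at elements of nonzero
  trace\<close>

text \<open>An Artin--Schreier root \<open>x\<close> of \<open>x\<^sup>3 - x = y\<close> is represented by the indeterminate modulo
  \<open>x\<^sup>3 - x - y\<close>.\<close>

definition artin_schreier :: "'a::field \<Rightarrow> 'a poly" where
  "artin_schreier y = [:0, 1:] ^ 3 - [:0, 1:] - [:y:]"

lemma artin_schreier_cong: "[[:0, 1:] ^ 3 - [:0, 1:] = [:y:]] (mod artin_schreier y)"
  by (simp add: cong_iff_dvd_diff artin_schreier_def)

text \<open>A modulus of degree at least 3 divides no nonzero constant. Hence identities between
  constants, proved modulo \<open>artin_schreier y\<close>, descend to the field.\<close>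

lemma artin_schreier_const_cong:
  assumes "[[:a:] = [:b:]] (mod artin_schreier y)"
  shows "a = b"
proof (rule ccontr)
  assume "a \<noteq> b"
  have "artin_schreier y dvd [:a - b:]" using assms by (simp add: cong_iff_dvd_diff)
  then have "degree (artin_schreier y) \<le> 0"
    using dvd_imp_degree_le[of "artin_schreier y" "[:a - b:]"] \<open>a \<noteq> b\<close> by simp
  moreover have "coeff (artin_schreier y) 3 = 1"
    by (simp add: artin_schreier_def x_pow_n coeff_pCons numeral_3_eq_3)
  ultimately show False using le_degree[of "artin_schreier y" 3] by simp
qed

text \<open>Cubing sends a root \<open>x\<close> to \<open>x + y\<close>; iterating gives
  \<open>x + y + y ^ 3\<close> and so on.\<close>

lemma artin_schreier_frobenius:
  fixes y :: "'a::field"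
  assumes "CHAR('a) = 3"
  shows "[[:0, 1:] ^ 3 ^ i = [:0, 1:] + [:trace_sum i y:]] (mod artin_schreier y)"
proof (induction i)
  case 0
  show ?case by (simp add: trace_sum_def)
next
  case (Suc i)
  have C: "CHAR('a poly) = 3" using assms by simp
  have "[([:0, 1:] ^ 3 ^ i) ^ 3 = ([:0, 1:] + [:trace_sum i y:]) ^ 3] (mod artin_schreier y)"
    using Suc by (rule cong_pow)
  also have "([:0, 1:] + [:trace_sum i y:]) ^ 3 = ([:0, 1:] ^ 3 - [:0, 1:]) + ([:0, 1:] + [:trace_sum i (y ^ 3):])"
    unfolding CHAR_3_cube_add[OF C] poly_const_pow trace_sum_cube[OF assms]
    by (simp only: add_diff_eq diff_add_eq add_diff_cancel_right' add_diff_cancel_left' add.commute add.left_commute)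
  also have "[\<dots> = [:y:] + ([:0, 1:] + [:trace_sum i (y ^ 3):])] (mod artin_schreier y)"
    by (intro cong_add artin_schreier_cong cong_refl)
  also have "([:0, 1:] ^ 3 ^ i) ^ 3 = ([:0, 1:] :: 'a poly) ^ 3 ^ Suc i"
    by (simp only: power_mult[symmetric] power_Suc2)
  also have "[:y:] + ([:0, 1:] + [:trace_sum i (y ^ 3):]) = [:0, 1:] + [:trace_sum (Suc i) y:]"
    by (simp add: trace_sum_Suc)
  finally show ?case .
qed

text \<open>The exponent 7 is what remains of 9 once a square has been split off to complete
  \<open>y ^ 2\<close> in the proof of \<open>shift_sum_trace_nonzero\<close>.\<close>

lemma shift_sum_7:
  assumes "CHAR('a::comm_ring_1) = 3"
  shows "shift_sum 7 (y :: 'a) = y"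
proof -
  have 7: "(7::nat) = Suc (Suc (Suc (Suc (Suc (Suc (Suc 0))))))" by simp
  have "shift_sum 7 y = y * 2 + y * 2"
    unfolding 7 shift_sum.simps by simp
  also have "\<dots> = y + 3 * y" by (simp add: algebra_simps)
  finally show ?thesis using CHAR_3_zero[OF assms] by simp
qed

text \<open>With \<open>y = u (u + t) (u + 2 t)\<close> and \<open>t\<^sup>2 = 1\<close> each summand is \<open>y\<^sup>\<alpha> y\<^sup>2 (u + 2 t)\<^sup>7\<close>.\<close>

lemma shift_sum_trace_nonzero:
  fixes y :: "'a::field"
  assumes CH: "CHAR('a) = 3"
    and t3: "trace_sum e y ^ 3 = trace_sum e y" and t0: "trace_sum e y \<noteq> 0"
    and n: "n = \<alpha> * (1 + 3 ^ e + 3 ^ (2 * e)) + (2 * (1 + 3 ^ e) + 3 ^ (2 * e + 2))"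
  shows "shift_sum n y = y ^ (\<alpha> + 3)"
proof -
  define t where "t = trace_sum e y"
  define X where "X = ([:0, 1:] :: 'a poly)"
  define T where "T = [:t:]"
  define M where "M = artin_schreier y"
  have C: "CHAR('a poly) = 3" using CH by simp
  note add3 = CHAR_3_cube_add[OF C] and two = CHAR_3_two[OF C]
  have XM: "[X ^ 3 - X = [:y:]] (mod M)" unfolding X_def M_def by (rule artin_schreier_cong)
  have T3: "T ^ 3 = T" using t3 by (simp add: T_def t_def poly_const_pow)
  \<comment> \<open>A nonzero \<open>t\<close> with \<open>t ^ 3 = t\<close> is 1 or -1.\<close>
  have "t * t = 1" using t3 t0 by (simp add: t_def power3_eq_cube)
  then have T2: "T * T = 1" by (simp add: T_def one_pCons)
  have F: "[X ^ 3 ^ e = X + T] (mod M)"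
    unfolding X_def T_def t_def M_def by (rule artin_schreier_frobenius[OF CH])
  \<comment> \<open>Frobenius fixes \<open>T\<close>, so its \<open>e\<close>-th power, applied a
    second time, adds \<open>T\<close> again.\<close>
  have "[(X ^ 3 ^ e) ^ 3 ^ e = (X + T) ^ 3 ^ e] (mod M)" using F by (rule cong_pow)
  also have "(X + T) ^ 3 ^ e = X ^ 3 ^ e + T"
    by (simp add: CHAR_3_frobenius_add[OF C] power_3_pow_fixed[OF T3])
  also have "[\<dots> = (X + T) + T] (mod M)" using F by (intro cong_add cong_refl)
  also have "(X ^ 3 ^ e) ^ 3 ^ e = X ^ 3 ^ (2 * e)"
    unfolding power_mult[symmetric] by (simp add: mult_2 power_add)
  also have "(X + T) + T = X + 2 * T" by (simp only: mult_2 add.assoc)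
  finally have F2: "[X ^ 3 ^ (2 * e) = X + 2 * T] (mod M)" .
  have main: "[(X + c) ^ n = [:y:] ^ (\<alpha> + 2) * ((X + 2 * T) + c) ^ 7] (mod M)" if c: "c ^ 3 = c" for c
  proof -
    define u where "u = X + c"
    have u3: "u ^ 3 - u = X ^ 3 - X" by (simp add: u_def add3 c)
    have U1: "[u ^ 3 ^ e = u + T] (mod M)"
    proof -
      have "u ^ 3 ^ e = X ^ 3 ^ e + c"
        by (simp add: u_def CHAR_3_frobenius_add[OF C] power_3_pow_fixed[OF c])
      also have "[\<dots> = (X + T) + c] (mod M)" using F by (intro cong_add cong_refl)
      finally show ?thesis by (simp add: u_def algebra_simps)
    qed
    have U2: "[u ^ 3 ^ (2 * e) = u + 2 * T] (mod M)"
    proof -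
      have "u ^ 3 ^ (2 * e) = X ^ 3 ^ (2 * e) + c"
        by (simp add: u_def CHAR_3_frobenius_add[OF C] power_3_pow_fixed[OF c])
      also have "[\<dots> = (X + 2 * T) + c] (mod M)" using F2 by (intro cong_add cong_refl)
      finally show ?thesis by (simp add: u_def algebra_simps)
    qed
    \<comment> \<open>As 2 = -1 and \<open>T * T = 1\<close>, this product is
      \<open>u ^ 3 - u\<close>, which does not change when \<open>u\<close> is shifted by
      \<open>c\<close>.\<close>
    have "u * (u + T) * (u + 2 * T) = u * (u * u - T * T)"
      by (simp add: two algebra_simps)
    also have "\<dots> = X ^ 3 - X" unfolding T2 u3[symmetric] by (simp add: power3_eq_cube algebra_simps)
    finally have Y: "[u * (u + T) * (u + 2 * T) = [:y:]] (mod M)" using XM by simp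
    have "u ^ n = (u * u ^ 3 ^ e * u ^ 3 ^ (2 * e)) ^ \<alpha> * ((u * u ^ 3 ^ e) ^ 2 * (u ^ 3 ^ (2 * e)) ^ 9)"
    proof -
      have "n = (1 + 3 ^ e + 3 ^ (2 * e)) * \<alpha> + ((1 + 3 ^ e) * 2 + 3 ^ (2 * e) * 9)"
        unfolding n by (simp add: power_add)
      then show ?thesis by (simp only: power_add power_mult power_one_right)
    qed
    also have "[\<dots> = (u * (u + T) * (u + 2 * T)) ^ \<alpha> * ((u * (u + T)) ^ 2 * (u + 2 * T) ^ 9)] (mod M)"
      by (intro cong_mult cong_pow cong_refl U1 U2)
    \<comment> \<open>The exponent 9 comes from \<open>3 ^ (2 * e + 2)\<close>; two of the nine
      factors complete the square of the product.\<close>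
    also have "(u * (u + T)) ^ 2 * (u + 2 * T) ^ 9 = (u * (u + T) * (u + 2 * T)) ^ 2 * (u + 2 * T) ^ 7"
      using power_add[of "u + 2 * T" 2 7] by (simp add: power_mult_distrib)
    also have "[(u * (u + T) * (u + 2 * T)) ^ \<alpha> * ((u * (u + T) * (u + 2 * T)) ^ 2 * (u + 2 * T) ^ 7)
        = [:y:] ^ \<alpha> * ([:y:] ^ 2 * (u + 2 * T) ^ 7)] (mod M)"
      by (intro cong_mult cong_pow cong_refl Y)
    also have "u + 2 * T = (X + 2 * T) + c" by (simp add: u_def)
    finally show ?thesis by (simp only: u_def power_add mult.assoc)
  qed
  have "[X ^ n + (X + 1) ^ n + (X + 2) ^ n =
      [:y:] ^ (\<alpha> + 2) * (X + 2 * T) ^ 7 + [:y:] ^ (\<alpha> + 2) * ((X + 2 * T) + 1) ^ 7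
        + [:y:] ^ (\<alpha> + 2) * ((X + 2 * T) + 2) ^ 7] (mod M)"
    using main[of 0] main[of 1] main[of 2] by (intro cong_add) (simp_all add: two)
  also have "[:y:] ^ (\<alpha> + 2) * (X + 2 * T) ^ 7 + [:y:] ^ (\<alpha> + 2) * ((X + 2 * T) + 1) ^ 7
        + [:y:] ^ (\<alpha> + 2) * ((X + 2 * T) + 2) ^ 7
      = [:y:] ^ (\<alpha> + 2) * ((X + 2 * T) ^ 7 + ((X + 2 * T) + 1) ^ 7 + ((X + 2 * T) + 2) ^ 7)"
    by (simp only: distrib_left)
  \<comment> \<open>By \<open>shift_sum_7\<close> the sum equals \<open>v ^ 3 - v\<close> for
    \<open>v = X + 2 * T\<close>, and the contribution of \<open>T\<close> cancels because
    \<open>T ^ 3 = T\<close>.\<close>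
  also have "(X + 2 * T) ^ 7 + ((X + 2 * T) + 1) ^ 7 + ((X + 2 * T) + 2) ^ 7 = X ^ 3 - X"
    unfolding shift_sum_eq[OF C] shift_sum_7[OF C] add3 by (simp add: two T3)
  also have "X ^ n + (X + 1) ^ n + (X + 2) ^ n = shift_sum n (X ^ 3 - X)" by (rule shift_sum_eq[OF C])
  finally have "[shift_sum n (X ^ 3 - X) = [:y:] ^ (\<alpha> + 2) * (X ^ 3 - X)] (mod M)" .
  moreover have "[[:y:] ^ (\<alpha> + 2) * (X ^ 3 - X) = [:y:] ^ (\<alpha> + 2) * [:y:]] (mod M)"
    by (intro cong_mult cong_refl XM)
  moreover have "[shift_sum n (X ^ 3 - X) = shift_sum n [:y:]] (mod M)"
    by (intro shift_sum_cong XM)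
  ultimately have "[shift_sum n [:y:] = [:y:] ^ (\<alpha> + 2) * [:y:]] (mod M)"
    by (blast intro: cong_trans cong_sym)
  moreover have "[:y:] ^ (\<alpha> + 2) * [:y:] = [:y:] ^ (\<alpha> + 3)"
    by (simp only: power_Suc2[symmetric] add_Suc_right[symmetric] eval_nat_numeral)
  ultimately have "[[:shift_sum n y:] = [:y ^ (\<alpha> + 3):]] (mod M)"
    by (simp only: shift_sum_const poly_const_pow)
  then show ?thesis unfolding M_def by (rule artin_schreier_const_cong)
qed

section \<open>Trace and Artin--Schreier map on the field with \<open>3 ^ e\<close> elements\<close>

lemma CHAR_eq_3:
  assumes "CARD('f::finite_field) = 3 ^ e"
  shows "CHAR('f) = 3"
proof -
  have "CHAR('f) dvd 3 ^ e" using CHAR_dvd_CARD[where ?'a = 'f] assms by simp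
  then have "CHAR('f) dvd 3" using CHAR_prime[where ?'a = 'f] prime_dvd_power by blast
  then show ?thesis using CHAR_prime[where ?'a = 'f] primes_dvd_imp_eq[of "CHAR('f)" 3] by simp
qed

lemma power_card_fixed:
  assumes "CARD('f::finite_field) = 3 ^ e"
  shows "(y :: 'f) ^ 3 ^ e = y"
  using finite_field_power_card_eq_same[of y] assms by simp

lemma power_card_minus_1:
  assumes "CARD('f::finite_field) = 3 ^ e" "(y :: 'f) \<noteq> 0"
  shows "y ^ (3 ^ e - 1) = 1"
proof -
  have "y * y ^ (3 ^ e - 1) = y ^ Suc (3 ^ e - 1)" by (simp only: power_Suc)
  also have "Suc (3 ^ e - 1) = (3 ^ e :: nat)" by simp
  finally show ?thesis using power_card_fixed[OF assms(1), of y] assms(2) by simp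
qed

text \<open>For nonzero \<open>x\<close> this is Fermat's theorem; positive exponents cover
  \<open>x = 0\<close>.\<close>

lemma power_cong_exponent:
  fixes x :: "'f::finite_field"
  assumes "CARD('f) = 3 ^ e" "[i = j] (mod 3 ^ e - 1)" "i > 0" "j > 0"
  shows "x ^ i = x ^ j"
proof (cases "x = 0")
  case True
  then show ?thesis using assms(3,4) by (simp add: zero_power)
next
  case False
  have *: "x ^ (k * (3 ^ e - 1)) = 1" for k
    using power_card_minus_1[OF assms(1) False] by (simp add: mult.commute[of k] power_mult)
  obtain k l where "i + k * (3 ^ e - 1) = j + l * (3 ^ e - 1)"
    using assms(2) unfolding cong_iff_lin_nat by (metis mult.commute)
  then have "x ^ (i + k * (3 ^ e - 1)) = x ^ (j + l * (3 ^ e - 1))" by simp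
  then show ?thesis unfolding power_add * by simp
qed

lemma trace_sum_fixed:
  assumes "CARD('f::finite_field) = 3 ^ e"
  shows "trace_sum e (y :: 'f) ^ 3 = trace_sum e y"
proof -
  \<comment> \<open>Both sides are \<open>trace_sum (Suc e) y\<close>, with the first or the last
    term split off.\<close>
  have "y + trace_sum e (y ^ 3) = trace_sum e y + y ^ 3 ^ e"
    unfolding trace_sum_Suc[symmetric] by (simp add: trace_sum_def)
  then show ?thesis
    unfolding trace_sum_cube[OF CHAR_eq_3[OF assms]] power_card_fixed[OF assms] by simp
qed

lemma trace_sum_minus:
  assumes "CHAR('a::comm_ring_1) = 3"
  shows "trace_sum e (- y :: 'a) = - trace_sum e y"
proof -
  have "trace_sum e (- y + y) = 0" by (simp add: trace_sum_def power_0_left)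
  then show ?thesis unfolding trace_sum_add[OF assms] by (simp only: eq_neg_iff_add_eq_0)
qed

lemma trace_sum_artin_schreier:
  assumes "CARD('f::finite_field) = 3 ^ e"
  shows "trace_sum e ((x :: 'f) ^ 3 - x) = 0"
proof -
  note C = CHAR_eq_3[OF assms]
  have "trace_sum e (x ^ 3 + - x) = trace_sum e x ^ 3 - trace_sum e x"
    unfolding trace_sum_add[OF C] trace_sum_minus[OF C] trace_sum_cube[OF C] by simp
  then show ?thesis by (simp add: trace_sum_fixed[OF assms])
qed

text \<open>Root counting for a nonzero polynomial of degree at most \<open>3 ^ d\<close>. It bounds
  the kernel of the trace and, later, the kernels of Frobenius polynomials.\<close>

lemma card_linearized_roots:
  fixes c :: "nat \<Rightarrow> 'a::field"
  assumes "c d \<noteq> 0"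
  shows "card {x. (\<Sum>i\<le>d. c i * x ^ 3 ^ i) = 0} \<le> 3 ^ d"
proof -
  define P where "P = (\<Sum>i\<le>d. monom (c i) (3 ^ i))"
  have "poly P x = (\<Sum>i\<le>d. c i * x ^ 3 ^ i)" for x
    by (simp add: P_def poly_sum poly_monom)
  moreover have "coeff P (3 ^ d) = c d"
  proof -
    have "coeff P (3 ^ d) = (\<Sum>i\<le>d. if i = d then c i else 0)"
      unfolding P_def coeff_sum by (intro sum.cong refl) simp
    then show ?thesis by simp
  qed
  then have "P \<noteq> 0" using assms by auto
  moreover have "degree P \<le> 3 ^ d"
    unfolding P_def by (intro degree_sum_le order.trans[OF degree_monom_le] power_increasing) auto
  ultimately show ?thesis using card_poly_roots_bound[of P] by simp
qed

text \<open>Additive Hilbert 90, by counting: the map \<open>x ^ 3 - x\<close> has fibres of at most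
  3 elements, so its image has at least \<open>3 ^ (e - 1)\<close>. The image lies in the trace
  kernel, which has at most that many.\<close>

lemma trace_sum_zero_artin_schreier:
  assumes CARD: "CARD('f::finite_field) = 3 ^ e" and e: "e > 0" and y: "trace_sum e (y :: 'f) = 0"
  shows "\<exists>x. y = x ^ 3 - x"
proof -
  note C = CHAR_eq_3[OF CARD]
  define f where "f x = x ^ 3 - x" for x :: 'f
  define K where "K = {y :: 'f. trace_sum e y = 0}"
  have sub: "range f \<subseteq> K" by (auto simp: f_def K_def trace_sum_artin_schreier[OF CARD])
  have eq: "{..<e} = {..e - 1}" using e by auto
  have "card K \<le> 3 ^ (e - 1)"
    using card_linearized_roots[of "\<lambda>_. 1 :: 'f" "e - 1"] by (simp add: K_def trace_sum_def eq)
  moreover have "3 ^ e \<le> card (range f) * 3"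
  proof -
    \<comment> \<open>Each \<open>x\<close> differs from the chosen preimage of \<open>f x\<close>
      by an element of the prime field.\<close>
    have "(UNIV :: 'f set) \<subseteq> (\<lambda>(z, c). inv_into UNIV f z + c) ` (range f \<times> {0, 1, 2})"
    proof
      fix x :: 'f
      define w where "w = inv_into UNIV f (f x)"
      have "f w = f x" unfolding w_def by (rule f_inv_into_f) simp
      then have "(x - w) ^ 3 = x - w"
        unfolding CHAR_3_cube_diff[OF C] by (simp add: f_def algebra_simps)
      then have "x - w \<in> {0, 1, 2}" using cube_eq_self_iff[OF C] by blast
      then have "(f x, x - w) \<in> range f \<times> {0, 1, 2}" by simp
      then show "x \<in> (\<lambda>(z, c). inv_into UNIV f z + c) ` (range f \<times> {0, 1, 2})"
        by (rule rev_image_eqI) (simp add: w_def)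
    qed
    then have "CARD('f) \<le> card (range f \<times> {0, 1, 2 :: 'f})"
      by (rule surj_card_le[rotated]) simp
    also have "\<dots> \<le> card (range f) * 3"
      unfolding card_cartesian_product using card_length[of "[0, 1, 2 :: 'f]"]
      by (intro mult_left_mono) simp_all
    finally show ?thesis using CARD by simp
  qed
  moreover have "(3::nat) ^ e = 3 ^ (e - 1) * 3" using e by (cases e) simp_all
  ultimately have "card K \<le> card (range f)" by simp
  then have "range f = K" using sub by (intro card_seteq) simp_all
  then show ?thesis using y by (auto simp: K_def f_def)
qed

section \<open>The embedding of the prime field and evaluation of \<open>g\<close>\<close>

lemma prime_field_emb_add:
  assumes "CHAR('f::finite_field) = 3"
  shows "(prime_field_emb (x + y :: F3) :: 'f) = prime_field_emb x + prime_field_emb y"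
proof -
  have "CARD(Enum.finite_3) = CHAR('f)" using assms by (simp add: UNIV_finite_3)
  then show ?thesis
    unfolding prime_field_emb_def to_int_mod_ring_add by (simp only: of_int_mod_CHAR of_int_add)
qed

lemma prime_field_emb_mult:
  assumes "CHAR('f::finite_field) = 3"
  shows "(prime_field_emb (x * y :: F3) :: 'f) = prime_field_emb x * prime_field_emb y"
proof -
  have "CARD(Enum.finite_3) = CHAR('f)" using assms by (simp add: UNIV_finite_3)
  then show ?thesis
    unfolding prime_field_emb_def to_int_mod_ring_mult by (simp only: of_int_mod_CHAR of_int_mult)
qed

lemma prime_field_emb_0: "prime_field_emb 0 = 0"
  by (simp add: prime_field_emb_def)

lemma prime_field_emb_1: "prime_field_emb 1 = 1"
  by (simp add: prime_field_emb_def)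

lemma prime_field_emb_of_nat:
  assumes "CHAR('f::finite_field) = 3"
  shows "prime_field_emb (of_nat k :: F3) = (of_nat k :: 'f)"
  by (induction k) (simp_all add: prime_field_emb_0 prime_field_emb_1 prime_field_emb_add[OF assms])

lemma prime_field_emb_cube:
  assumes "CHAR('f::finite_field) = 3"
  shows "(prime_field_emb (c :: F3) :: 'f) ^ 3 = prime_field_emb c"
proof -
  have "c ^ 3 = c" using finite_field_power_card_eq_same[of c] unfolding CARD_F3 .
  then show ?thesis by (metis power3_eq_cube prime_field_emb_mult[OF assms])
qed

lemma prime_field_emb_eq_0:
  assumes "CHAR('f::finite_field) = 3" "(prime_field_emb (c :: F3) :: 'f) = 0"
  shows "c = 0"
proof (rule ccontr)
  assume "c \<noteq> 0"
  then have "prime_field_emb (c * inverse c) = (1 :: 'f)" by (simp add: prime_field_emb_1)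
  then show False using assms by (simp add: prime_field_emb_mult)
qed

lemma map_poly_prime_field_emb_shift_sum:
  assumes C: "CHAR('f::finite_field) = 3"
  shows "map_poly prime_field_emb (shift_sum n [:0, 1:] :: F3 poly) = (shift_sum n [:0, 1:] :: 'f poly)"
proof -
  have add: "map_poly prime_field_emb (p + q :: F3 poly)
      = (map_poly prime_field_emb p + map_poly prime_field_emb q :: 'f poly)" for p q
    by (rule poly_eqI) (simp add: coeff_map_poly prime_field_emb_0 prime_field_emb_add[OF C])
  have X: "[:0, 1:] * p = pCons 0 p" "[:0, 1:] * q = pCons 0 q"
    for p :: "F3 poly" and q :: "'f poly"
    by simp_all
  have pCons: "map_poly prime_field_emb (pCons c p :: F3 poly)
      = (pCons (prime_field_emb c) (map_poly prime_field_emb p) :: 'f poly)" for c p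
    by (rule poly_eqI) (simp add: coeff_map_poly prime_field_emb_0 coeff_pCons split: nat.split)
  have two: "prime_field_emb (2 :: F3) = (2 :: 'f)"
    using prime_field_emb_of_nat[OF C, of 2] by simp
  show ?thesis
  proof (induction n "[:0, 1:] :: F3 poly" rule: shift_sum.induct)
    case 3
    show ?case by (simp add: numeral_poly pCons two)
  next
    case (4 n)
    then show ?case by (simp only: shift_sum.simps add X pCons prime_field_emb_0)
  qed simp_all
qed

lemma poly_map_g_poly:
  assumes "CHAR('f::finite_field) = 3"
  shows "poly (map_poly prime_field_emb (g_poly TYPE(F3) n :: F3 poly)) (y :: 'f) = shift_sum n y"
  by (simp add: g_poly_F3 map_poly_prime_field_emb_shift_sum[OF assms] poly_shift_sum)

section \<open>Linearized polynomials as an action of polynomials over \<open>F3\<close>\<close>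

text \<open>The indeterminate acts as Frobenius, which makes the field a module over the polynomial
  ring; \<open>frobenius_act p\<close> is the linearized polynomial associated with
  \<open>p\<close>.\<close>

definition frobenius_act :: "F3 poly \<Rightarrow> 'f::finite_field \<Rightarrow> 'f" where
  "frobenius_act p x = (\<Sum>i\<le>degree p. prime_field_emb (coeff p i) * x ^ 3 ^ i)"

lemma frobenius_act_eq_sum:
  assumes "degree p \<le> n"
  shows "frobenius_act p x = (\<Sum>i\<le>n. prime_field_emb (coeff p i) * x ^ 3 ^ i)"
  unfolding frobenius_act_def
  by (rule sum.mono_neutral_left) (use assms in \<open>auto simp: coeff_eq_0 prime_field_emb_0\<close>)

lemma frobenius_act_0_left: "frobenius_act 0 x = 0"
  by (simp add: frobenius_act_def prime_field_emb_0)

lemma frobenius_act_0_right: "frobenius_act p 0 = 0"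
  by (simp add: frobenius_act_def power_0_left)

lemma frobenius_act_pCons:
  "frobenius_act (pCons c p) x = prime_field_emb c * x + frobenius_act p (x ^ 3)"
proof -
  have "frobenius_act (pCons c p) x
      = (\<Sum>i\<le>Suc (degree p). prime_field_emb (coeff (pCons c p) i) * x ^ 3 ^ i)"
    by (rule frobenius_act_eq_sum) (rule degree_pCons_le)
  then show ?thesis
    unfolding sum.atMost_Suc_shift frobenius_act_def by (simp add: power_mult)
qed

lemma frobenius_act_monom: "frobenius_act (monom c i) x = prime_field_emb c * x ^ 3 ^ i"
  by (induction i arbitrary: x)
    (simp_all add: monom_0 monom_Suc frobenius_act_pCons frobenius_act_0_left prime_field_emb_0 power_mult)

context
  assumes C: "CHAR('f::finite_field) = 3"
begin

lemma frobenius_act_add_left: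
  "frobenius_act (p + q) (x :: 'f) = frobenius_act p x + frobenius_act q x"
proof -
  define n where "n = max (degree p) (degree q)"
  have "degree p \<le> n" "degree q \<le> n" "degree (p + q) \<le> n"
    by (simp_all add: n_def degree_add_le_max)
  then show ?thesis
    by (simp add: frobenius_act_eq_sum[of _ n] prime_field_emb_add[OF C] distrib_right sum.distrib)
qed

lemma frobenius_act_diff_left:
  "frobenius_act (p - q) (x :: 'f) = frobenius_act p x - frobenius_act q x"
  using frobenius_act_add_left[of "p - q" q x] by simp

lemma frobenius_act_sum_left:
  "frobenius_act (\<Sum>i\<in>I. p i) (x :: 'f) = (\<Sum>i\<in>I. frobenius_act (p i) x)"
  by (induction I rule: infinite_finite_induct)
    (simp_all add: frobenius_act_0_left frobenius_act_add_left)

lemma frobenius_act_add_right: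
  "frobenius_act p (x + y :: 'f) = frobenius_act p x + frobenius_act p y"
  by (simp add: frobenius_act_def CHAR_3_frobenius_add[OF C] distrib_left sum.distrib)

lemma frobenius_act_diff_right:
  "frobenius_act p (x - y :: 'f) = frobenius_act p x - frobenius_act p y"
  using frobenius_act_add_right[of p "x - y" y] by simp

text \<open>The coefficients lie in the prime field, so cubing fixes them.\<close>

lemma frobenius_act_cube: "frobenius_act p (x ^ 3 :: 'f) = frobenius_act p x ^ 3"
proof -
  have "frobenius_act p x ^ 3 = (\<Sum>i\<le>degree p. (prime_field_emb (coeff p i) * x ^ 3 ^ i) ^ 3)"
    unfolding frobenius_act_def by (rule freshmans_dream_sum) (simp_all add: C)
  then show ?thesis
    by (simp only: frobenius_act_def power_mult_distrib prime_field_emb_cube[OF C] power_cube_commute)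
qed

lemma frobenius_act_smult:
  "frobenius_act (smult c p) (x :: 'f) = prime_field_emb c * frobenius_act p x"
  by (induction p arbitrary: x)
    (simp_all add: frobenius_act_0_left frobenius_act_pCons prime_field_emb_mult[OF C] distrib_left
      mult.assoc)

text \<open>Multiplication of polynomials becomes composition. The induction step moves one
  Frobenius past the action of \<open>p\<close>.\<close>

lemma frobenius_act_mult:
  "frobenius_act (p * q) (x :: 'f) = frobenius_act p (frobenius_act q x)"
proof (induction p arbitrary: x)
  case 0
  show ?case by (simp add: frobenius_act_0_left)
next
  case (pCons c p)
  show ?case
    by (simp add: frobenius_act_add_left frobenius_act_smult frobenius_act_pCons pCons.IH
        prime_field_emb_0 frobenius_act_cube)
qed

lemma frobenius_act_1: "frobenius_act 1 (x :: 'f) = x"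
  unfolding one_pCons frobenius_act_pCons frobenius_act_0_left prime_field_emb_1 by simp

lemma frobenius_act_X_minus_1: "frobenius_act ([:0, 1:] - 1) (x :: 'f) = x ^ 3 - x"
  unfolding frobenius_act_diff_left frobenius_act_1
  by (simp add: frobenius_act_pCons frobenius_act_0_left prime_field_emb_0 prime_field_emb_1)

end

lemma frobenius_act_X_pow_minus_1:
  assumes "CARD('f::finite_field) = 3 ^ e"
  shows "frobenius_act (monom 1 e - 1) (x :: 'f) = 0"
  unfolding frobenius_act_diff_left[OF CHAR_eq_3[OF assms]] frobenius_act_1[OF CHAR_eq_3[OF assms]]
    frobenius_act_monom power_card_fixed[OF assms] prime_field_emb_1 by simp

text \<open>A linearized polynomial of degree \<open>3 ^ degree p\<close>, below the field size,
  cannot vanish everywhere. So no nonzero polynomial of degree below \<open>e\<close> annihilates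
  the field.\<close>

lemma frobenius_act_nonzero:
  assumes CARD: "CARD('f::finite_field) = 3 ^ e" and "p \<noteq> 0" "degree p < e"
  shows "\<exists>x :: 'f. frobenius_act p x \<noteq> 0"
proof (rule ccontr)
  assume "\<not> ?thesis"
  then have "{x :: 'f. frobenius_act p x = 0} = UNIV" by auto
  moreover have "prime_field_emb (coeff p (degree p)) \<noteq> (0 :: 'f)"
    using prime_field_emb_eq_0[OF CHAR_eq_3[OF CARD]] \<open>p \<noteq> 0\<close> by (metis leading_coeff_0_iff)
  ultimately have "CARD('f) \<le> 3 ^ degree p"
    using card_linearized_roots[of "\<lambda>i. prime_field_emb (coeff p i) :: 'f" "degree p"]
    by (simp add: frobenius_act_def)
  moreover have "(3::nat) ^ degree p < 3 ^ e" using assms(3) by simp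
  ultimately show False using CARD by simp
qed

text \<open>Forward, Bezout puts the kernel of \<open>A\<close> inside that of the gcd. Backward,
  the cofactor \<open>c\<close> of the gcd in \<open>E\<close> maps the field into the kernel of
  \<open>A\<close>, so \<open>L * c\<close> annihilates the field; its degree then leaves no room
  for a further factor \<open>h\<close> of the gcd.\<close>

lemma gcd_eq_X_minus_1_iff:
  fixes A :: "F3 poly"
  assumes CARD: "CARD('f::finite_field) = 3 ^ e" and e: "e > 0" and A1: "[:0, 1:] - 1 dvd A"
  shows "gcd A (monom 1 e - 1) = [:0, 1:] - 1 \<longleftrightarrow>
    (\<forall>x :: 'f. frobenius_act A x = 0 \<longrightarrow> x ^ 3 = x)"
proof -
  note C = CHAR_eq_3[OF CARD]
  define L where "L = ([:0, 1:] - 1 :: F3 poly)"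
  define E where "E = (monom 1 e - 1 :: F3 poly)"
  have L: "L = [:- 1, 1:]" by (simp add: L_def one_pCons)
  have E0: "frobenius_act E x = 0" for x :: 'f
    unfolding E_def by (rule frobenius_act_X_pow_minus_1[OF CARD])
  have Lact: "frobenius_act L x = x ^ 3 - x" for x :: 'f
    unfolding L_def by (rule frobenius_act_X_minus_1[OF C])
  have degE: "degree E = e"
    unfolding E_def diff_conv_add_uminus using e
    by (subst degree_add_eq_left) (simp_all add: degree_monom_eq)
  have "poly E 1 = 0" by (simp add: E_def poly_monom)
  then have LE: "L dvd E" by (simp add: L poly_eq_0_iff_dvd)
  have "gcd A E = L \<longleftrightarrow> (\<forall>x :: 'f. frobenius_act A x = 0 \<longrightarrow> x ^ 3 = x)"
  proof
    assume g: "gcd A E = L"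
    obtain u v where uv: "u * A + v * E = gcd A E"
      using bezout_coefficients_fst_snd[of A E] by blast
    show "\<forall>x :: 'f. frobenius_act A x = 0 \<longrightarrow> x ^ 3 = x"
    proof (intro allI impI)
      fix x :: 'f assume x: "frobenius_act A x = 0"
      have "frobenius_act L x = frobenius_act u (frobenius_act A x) + frobenius_act v (frobenius_act E x)"
        unfolding g[symmetric] uv[symmetric] frobenius_act_add_left[OF C] frobenius_act_mult[OF C] ..
      then show "x ^ 3 = x" unfolding Lact x E0 frobenius_act_0_right by simp
    qed
  next
    assume R: "\<forall>x :: 'f. frobenius_act A x = 0 \<longrightarrow> x ^ 3 = x"
    have "L dvd gcd A E" using A1 LE by (simp add: L_def)
    then obtain h where h: "gcd A E = L * h" by (elim dvdE)
    obtain c where c: "E = gcd A E * c" using gcd_dvd2[of A E] by (elim dvdE)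
    obtain A' where A': "A = gcd A E * A'" using gcd_dvd1[of A E] by (elim dvdE)
    have E_ne: "E \<noteq> 0" using degE e by auto
    then have ne: "L \<noteq> 0" "h \<noteq> 0" "c \<noteq> 0" using c h by auto
    have "frobenius_act (L * c) z = 0" for z :: 'f
    proof -
      \<comment> \<open>\<open>A * c\<close> is a multiple of \<open>gcd A E * c = E\<close>, which
        acts as zero.\<close>
      have "frobenius_act A (frobenius_act c z) = frobenius_act (A' * E) z"
        unfolding frobenius_act_mult[OF C, symmetric] by (metis A' c mult.assoc mult.commute)
      also have "\<dots> = 0" unfolding frobenius_act_mult[OF C] E0 frobenius_act_0_right ..
      finally show ?thesis using R by (simp add: frobenius_act_mult[OF C] Lact)
    qed
    then have "\<not> degree (L * c) < e"
      using frobenius_act_nonzero[OF CARD, of "L * c"] ne by auto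
    moreover have "degree E = degree L + degree h + degree c"
      using c ne unfolding h by (metis degree_mult_eq mult_eq_0_iff)
    ultimately have "degree h = 0" using degE ne by (simp add: degree_mult_eq)
    then have "is_unit h" using ne by (simp add: is_unit_iff_degree)
    then have "gcd A E dvd L" unfolding h by (simp add: mult_unit_dvd_iff)
    then have "normalize (gcd A E) = normalize L"
      using \<open>L dvd gcd A E\<close> by (rule associatedI)
    moreover have "normalize L = L"
      by (simp add: L normalize_poly_def flip: one_pCons)
    ultimately show "gcd A E = L" by simp
  qed
  then show ?thesis by (simp only: L_def E_def)
qed

section \<open>Base-3 digits, digit sum 3, and the reduced exponent\<close>

text \<open>Listing positions with multiplicity turns a digit vector of sum 3 into a list of three
  positions.\<close>

definition digit_list :: "nat \<Rightarrow> (nat \<Rightarrow> nat) \<Rightarrow> nat list" where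
  "digit_list e a = concat (map (\<lambda>i. replicate (a i) i) [0..<e])"

lemma length_digit_list: "length (digit_list e a) = (\<Sum>i<e. a i)"
  by (induction e) (simp_all add: digit_list_def)

lemma sum_list_digit_list:
  "sum_list (map f (digit_list e a)) = (\<Sum>i<e. of_nat (a i) * f i)" for f :: "nat \<Rightarrow> 'a::comm_ring_1"
  by (induction e) (simp_all add: digit_list_def sum_list_replicate)

lemma prod_list_digit_list:
  "prod_list (map f (digit_list e a)) = (\<Prod>i<e. f i ^ a i)" for f :: "nat \<Rightarrow> 'a::comm_ring_1"
  by (induction e) (simp_all add: digit_list_def)

text \<open>Here \<open>N\<close> is \<open>3 ^ i + 3 ^ j + 3 ^ k\<close>, so each power is a
  product of three additive maps. In the expansion the quadratic terms and the constants cancel, the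
  cubic term has coefficient 3, and the linear terms have coefficient 2 = -1.\<close>

lemma sum_shifts_digit_sum_3:
  fixes x :: "'a::comm_ring_1"
  assumes C: "CHAR('a) = 3" and a: "(\<Sum>i<e. a i) = 3" and N: "N = (\<Sum>i<e. a i * 3 ^ i)"
  shows "x ^ N + (x + 1) ^ N + (x + 2) ^ N = - (\<Sum>i<e. of_nat (a i) * x ^ 3 ^ i)"
proof -
  obtain i j k where ijk: "digit_list e a = [i, j, k]"
    using length_digit_list[of e a] a
    by (auto simp: numeral_3_eq_3 length_Suc_conv)
  have power: "y ^ N = y ^ 3 ^ i * y ^ 3 ^ j * y ^ 3 ^ k" for y :: 'a
  proof -
    have "y ^ N = (\<Prod>i<e. (y ^ 3 ^ i) ^ a i)"
      unfolding N power_sum by (intro prod.cong refl) (simp add: power_mult[symmetric] mult.commute)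
    then show ?thesis
      unfolding prod_list_digit_list[symmetric] ijk by (simp add: mult.assoc)
  qed
  have shift: "(x + 1) ^ 3 ^ m = x ^ 3 ^ m + 1" "(x - 1) ^ 3 ^ m = x ^ 3 ^ m - 1" for m
    by (simp_all add: CHAR_3_frobenius_add[OF C] CHAR_3_frobenius_diff[OF C])
  have sum: "(\<Sum>i<e. of_nat (a i) * x ^ 3 ^ i) = x ^ 3 ^ i + x ^ 3 ^ j + x ^ 3 ^ k"
    unfolding sum_list_digit_list[symmetric] ijk by (simp add: add.assoc)
  have cubic: "p * q * r + (p + 1) * (q + 1) * (r + 1) + (p - 1) * (q - 1) * (r - 1)
      = 3 * (p * q * r) + 3 * (p + q + r) - (p + q + r)" for p q r :: 'a
    by (simp add: algebra_simps)
  have "x + 2 = x - 1" by (simp add: CHAR_3_two[OF C])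
  then show ?thesis
    unfolding sum by (simp only: power shift cubic) (simp add: CHAR_3_zero[OF C])
qed

lemma w3_eq_sum:
  assumes "m \<le> N"
  shows "w3 m = (\<Sum>i<N. m div 3 ^ i mod 3)"
  unfolding w3_def
proof (rule sum.mono_neutral_left)
  show "\<forall>i\<in>{..<N} - {..<m}. m div 3 ^ i mod 3 = 0"
  proof
    fix i assume "i \<in> {..<N} - {..<m}"
    then have "m \<le> i" by simp
    also have "i < 2 ^ i" by (rule less_exp)
    also have "\<dots> \<le> 3 ^ i" by (rule power_mono) simp_all
    finally have "m < 3 ^ i" .
    then show "m div 3 ^ i mod 3 = 0" by simp
  qed
qed (use assms in auto)

lemma w3_step:
  assumes "b \<le> 2"
  shows "w3 (b + 3 * m) = b + w3 m"
proof -
  have "w3 (b + 3 * m) = (\<Sum>i<Suc (b + 3 * m). (b + 3 * m) div 3 ^ i mod 3)"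
    by (rule w3_eq_sum) simp
  also have "\<dots> = (b + 3 * m) mod 3 + (\<Sum>i<b + 3 * m. m div 3 ^ i mod 3)"
    unfolding sum.lessThan_Suc_shift using assms by (simp add: div_mult2_eq)
  also have "(\<Sum>i<b + 3 * m. m div 3 ^ i mod 3) = w3 m"
    by (rule w3_eq_sum[symmetric]) simp
  finally show ?thesis using assms by simp
qed

lemma w3_digits:
  assumes "\<forall>i<e. a i \<le> 2"
  shows "w3 (\<Sum>i<e. a i * 3 ^ i) = (\<Sum>i<e. a i)"
  using assms
proof (induction e arbitrary: a)
  case 0
  show ?case by (simp add: w3_def)
next
  case (Suc e)
  have "(\<Sum>i<Suc e. a i * 3 ^ i) = a 0 + 3 * (\<Sum>i<e. a (Suc i) * 3 ^ i)"
    unfolding sum.lessThan_Suc_shift by (simp add: sum_distrib_left mult.left_commute)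
  then show ?case
    using Suc.prems Suc.IH[of "\<lambda>i. a (Suc i)"] by (simp add: w3_step sum.lessThan_Suc_shift del: sum.lessThan_Suc)
qed

lemma dagger:
  assumes "e > 0"
  shows "1 \<le> dagger e m" "[int (dagger e m) = m] (mod 3 ^ e - 1)"
proof -
  define M where "M = (3 ^ e - 1 :: int)"
  have "(3::int) ^ 1 \<le> 3 ^ e" using assms by (intro power_increasing) auto
  then have M: "M > 0" by (simp add: M_def)
  have nat_M: "r \<le> 3 ^ e - 1 \<longleftrightarrow> int r \<le> M" for r :: nat
    by (simp add: M_def of_nat_diff flip: of_nat_le_iff[where ?'a = int])
  define P where "P r \<longleftrightarrow> 1 \<le> r \<and> r \<le> 3 ^ e - 1 \<and> [int r = m] (mod 3 ^ e - 1)" for r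
  have "\<exists>!r. P r"
  proof (rule ex1I)
    \<comment> \<open>Shifting by one before and after \<open>mod\<close> selects the representative
      in 1 to \<open>M\<close> instead of 0 to \<open>M - 1\<close>.\<close>
    have "0 \<le> (m - 1) mod M" "(m - 1) mod M < M" using M by simp_all
    moreover have "[(m - 1) mod M + 1 = (m - 1) + 1] (mod M)"
      by (simp add: cong_def mod_simps)
    ultimately show "P (nat ((m - 1) mod M + 1))"
      unfolding P_def nat_M by (simp add: M_def)
  next
    fix r assume "P r"
    then have r: "1 \<le> int r" "int r \<le> M" "[int r = m] (mod M)"
      unfolding P_def nat_M by (simp_all add: M_def)
    have "[int r - 1 = m - 1] (mod M)" using r(3) by (intro cong_diff cong_refl)
    then have "(int r - 1) mod M = (m - 1) mod M" by (simp add: cong_def)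
    then have "int r - 1 = (m - 1) mod M" using r by simp
    then show "r = nat ((m - 1) mod M + 1)" by simp
  qed
  then have "P (dagger e m)" unfolding dagger_def P_def by (rule theI')
  then show "1 \<le> dagger e m" "[int (dagger e m) = m] (mod 3 ^ e - 1)" by (simp_all add: P_def)
qed

section \<open>Injectivity on elements of nonzero trace\<close>

lemma even_half_3_pow_minus_1:
  assumes "even e"
  shows "even ((3 ^ e - 1) div 2 :: nat)"
proof -
  obtain j where e: "e = 2 * j" using assms by (elim evenE)
  have "\<exists>k. (9::nat) ^ j = 4 * k + 1"
  proof (induction j)
    case (Suc j)
    then obtain k where "(9::nat) ^ j = 4 * k + 1" ..
    then have "(9::nat) ^ Suc j = 4 * (9 * k + 2) + 1" by simp
    then show ?case ..
  qed simp
  then obtain k where "(9::nat) ^ j = 4 * k + 1" ..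
  then have "(3::nat) ^ e = 4 * k + 1" by (simp add: e power_mult)
  then show ?thesis by simp
qed

text \<open>The factor \<open>y ^ k\<close> squares to 1, so \<open>f\<close> is a power of
  Frobenius up to sign, and the trace stays nonzero. If the signs at \<open>y\<close> and
  \<open>z\<close> agree, Frobenius is injective; if they differ, then \<open>z = - y\<close>, but
  \<open>k\<close> is even, so the signs would agree after all.\<close>

lemma twisted_frobenius_trace:
  fixes f :: "'f::finite_field \<Rightarrow> 'f"
  assumes CARD: "CARD('f) = 3 ^ e" and se: "even (s * e)"
    and f: "\<And>y. trace_sum e y \<noteq> 0 \<Longrightarrow> f y = y ^ (3 ^ l + s * ((3 ^ e - 1) div 2))"
  shows "trace_sum e y \<noteq> 0 \<Longrightarrow> trace_sum e (f y) \<noteq> 0"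
    and "trace_sum e y \<noteq> 0 \<Longrightarrow> trace_sum e z \<noteq> 0 \<Longrightarrow> f y = f z \<Longrightarrow> y = z"
proof -
  note C = CHAR_eq_3[OF CARD]
  define k where "k = s * ((3 ^ e - 1) div 2)"
  have "even k" using se even_half_3_pow_minus_1[of e] by (auto simp: k_def)
  have sign: "y ^ k = 1 \<or> y ^ k = - 1" if "trace_sum e y \<noteq> 0" for y :: 'f
  proof -
    have "y \<noteq> 0" using that by (auto simp: trace_sum_def power_0_left)
    have "even (3 ^ e - 1 :: nat)" by simp
    then have "(3 ^ e - 1) div 2 * 2 = (3 ^ e - 1 :: nat)" by (rule dvd_div_mult_self)
    then have "k * 2 = (3 ^ e - 1) * s" unfolding k_def by (metis mult.assoc mult.commute)
    then have "(y ^ k) ^ 2 = (y ^ (3 ^ e - 1)) ^ s" by (simp only: power_mult[symmetric])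
    also have "\<dots> = 1" unfolding power_card_minus_1[OF CARD \<open>y \<noteq> 0\<close>] by (rule power_one)
    finally have "(y ^ k) ^ 2 = 1" .
    then show ?thesis by (simp add: power2_eq_1_iff)
  qed
  have f': "f y = y ^ 3 ^ l * y ^ k" if "trace_sum e y \<noteq> 0" for y
    using f[OF that] by (simp add: k_def power_add)
  show "trace_sum e (f y) \<noteq> 0" if "trace_sum e y \<noteq> 0" for y
    using sign[OF that] that unfolding f'[OF that]
    by (auto simp: trace_sum_minus[OF C] trace_sum_frobenius[OF C])
  show "y = z" if y: "trace_sum e y \<noteq> 0" and z: "trace_sum e z \<noteq> 0" and eq: "f y = f z" for y z
  proof -
    have eq': "y ^ 3 ^ l * y ^ k = z ^ 3 ^ l * z ^ k" using eq unfolding f'[OF y] f'[OF z] .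
    have z0: "z ^ k \<noteq> 0" using sign[OF z] by (metis neg_equal_0_iff_equal zero_neq_one)
    show ?thesis
    proof (cases "y ^ k = z ^ k")
      case True
      have "y ^ 3 ^ l * z ^ k = z ^ 3 ^ l * z ^ k" using eq' unfolding True .
      then have "y ^ 3 ^ l = z ^ 3 ^ l" by (rule mult_right_cancel[OF z0, THEN iffD1])
      then show ?thesis by (rule frobenius_inj[OF C])
    next
      case False
      then have "y ^ k = - (z ^ k)" using sign[OF y] sign[OF z] by (metis minus_minus)
      then have "- (y ^ 3 ^ l) * z ^ k = z ^ 3 ^ l * z ^ k"
        using eq' by (simp only: minus_mult_commute)
      then have "- (y ^ 3 ^ l) = z ^ 3 ^ l" by (rule mult_right_cancel[OF z0, THEN iffD1])
      then have "(- y) ^ 3 ^ l = z ^ 3 ^ l" by simp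
      then have "- y = z" by (rule frobenius_inj[OF C])
      then show ?thesis using False \<open>even k\<close> by auto
    qed
  qed
qed

theorem theorem3p8:
  fixes e \<alpha> \<beta> n :: nat and a :: "nat \<Rightarrow> nat"
  assumes "e > 2"
    and "\<beta> = 2 * (1 + 3 ^ e) + 3 ^ (2 * e + 2)"
    and "w3 (dagger e (3 * int \<alpha> + int \<beta>)) = 3"
    and "\<exists>l s :: nat. l < e \<and> even (s * e) \<and> \<alpha> + 3 = 3 ^ l + s * ((3 ^ e - 1) div 2)"
    and "n = \<alpha> * (1 + 3 ^ e + 3 ^ (2 * e)) + \<beta>"
    and "\<forall>i<e. a i \<le> 2"
    and "dagger e (3 * int \<alpha> + int \<beta>) = (\<Sum>i<e. a i * 3 ^ i)"
    and "CARD('f::finite_field) = 3 ^ e"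
  shows "permutation_poly (map_poly prime_field_emb (g_poly TYPE(F3) n :: F3 poly) :: 'f poly) \<longleftrightarrow>
    gcd (\<Sum>i<e. monom (of_nat (a i)) i) (monom 1 e - 1) = ([:0, 1:] - 1 :: F3 poly)"
proof -
  note CARD = assms(8)
  note C = CHAR_eq_3[OF CARD]
  have e: "e > 0" using assms(1) by simp
  define f :: "'f \<Rightarrow> 'f" where "f = shift_sum n"
  define N where "N = dagger e (3 * int \<alpha> + int \<beta>)"
  define A :: "F3 poly" where "A = (\<Sum>i<e. monom (of_nat (a i)) i)"
  have sum_a: "(\<Sum>i<e. a i) = 3" using assms(3) w3_digits[OF assms(6)] assms(7) by simp
  have Aact: "frobenius_act A x = (\<Sum>i<e. of_nat (a i) * x ^ 3 ^ i)" for x :: 'f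
    unfolding A_def frobenius_act_sum_left[OF C] frobenius_act_monom prime_field_emb_of_nat[OF C] ..
  \<comment> \<open>The digit sum 3 vanishes in \<open>F3\<close>, so 1 is a root of
    \<open>A\<close>.\<close>
  have LA: "[:0, 1:] - 1 dvd A"
  proof -
    have "poly A 1 = of_nat (\<Sum>i<e. a i)" by (simp add: A_def poly_sum poly_monom)
    also have "\<dots> = 0" unfolding sum_a using CHAR_3_zero[OF CHAR_F3] by simp
    finally have "[:- 1, 1:] dvd A" by (simp add: poly_eq_0_iff_dvd)
    then show ?thesis by (simp add: one_pCons)
  qed

  have "[int n = 3 * int \<alpha> + int \<beta>] (mod 3 ^ e - 1)"
  proof -
    have 1: "[3 ^ e = 1] (mod 3 ^ e - 1 :: int)" by (simp add: cong_iff_dvd_diff)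
    have "[(3 ^ e) ^ 2 = 1 ^ 2] (mod 3 ^ e - 1 :: int)" using 1 by (rule cong_pow)
    then have 2: "[3 ^ (2 * e) = 1] (mod 3 ^ e - 1 :: int)"
      by (simp add: power_mult[symmetric] mult.commute)
    have "[int \<alpha> * (1 + 3 ^ e + 3 ^ (2 * e)) + int \<beta> = int \<alpha> * (1 + 1 + 1) + int \<beta>] (mod 3 ^ e - 1)"
      by (intro cong_add cong_mult cong_refl 1 2)
    moreover have "int n = int \<alpha> * (1 + 3 ^ e + 3 ^ (2 * e)) + int \<beta>"
      by (simp only: assms(5) of_nat_add of_nat_mult of_nat_power of_nat_1 of_nat_numeral)
    moreover have "int \<alpha> * (1 + 1 + 1) = 3 * int \<alpha>" by simp
    ultimately show ?thesis by (simp only:)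
  qed
  then have "[int n = int N] (mod 3 ^ e - 1)"
    using dagger(2)[OF e, of "3 * int \<alpha> + int \<beta>"] unfolding N_def by (blast intro: cong_trans cong_sym)
  moreover have "(3 ^ e - 1 :: int) = int (3 ^ e - 1)" by (simp add: of_nat_diff)
  ultimately have "[n = N] (mod 3 ^ e - 1)" by (simp only: cong_int_iff)
  \<comment> \<open>Both exponents must be positive for the powers to agree at 0 as well.\<close>
  moreover have "\<beta> > 0" unfolding assms(2) by (rule add_pos_nonneg) simp_all
  then have "n > 0" unfolding assms(5) by (rule add_nonneg_pos[OF le0])
  moreover have "N > 0" using dagger(1)[OF e] unfolding N_def by (simp add: Suc_le_eq)
  ultimately have pow: "u ^ n = u ^ N" for u :: 'f by (rule power_cong_exponent[OF CARD])
  have zero: "f (x ^ 3 - x) = - frobenius_act A x" for x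
    unfolding f_def shift_sum_eq[OF C, symmetric] pow Aact
    by (rule sum_shifts_digit_sum_3[OF C sum_a]) (simp only: N_def assms(7))

  have nonzero: "f y = y ^ (\<alpha> + 3)" if "trace_sum e y \<noteq> 0" for y
    unfolding f_def
    by (rule shift_sum_trace_nonzero[OF C trace_sum_fixed[OF CARD] that]) (simp only: assms(5,2))
  obtain l s where "even (s * e)" and ls: "\<alpha> + 3 = 3 ^ l + s * ((3 ^ e - 1) div 2)"
    using assms(4) by blast
  note twisted = twisted_frobenius_trace[OF CARD this(1) nonzero[unfolded ls]]

  \<comment> \<open>Together with \<open>twisted(1)\<close> this shows that \<open>f\<close>
    respects the partition by zero and nonzero trace, so injectivity can be tested on each class.
    The factor \<open>[:0, 1:] - 1\<close> of \<open>A\<close> puts the value in the image of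
    \<open>x ^ 3 - x\<close>.\<close>
  have trace_zero: "trace_sum e (f y) = 0" if y: "trace_sum e y = 0" for y
  proof -
    obtain x where x: "y = x ^ 3 - x" using trace_sum_zero_artin_schreier[OF CARD e y] ..
    obtain B where "A = ([:0, 1:] - 1) * B" using LA by (elim dvdE)
    then show ?thesis
      unfolding x zero trace_sum_minus[OF C]
      by (simp add: frobenius_act_mult[OF C] frobenius_act_X_minus_1[OF C]
          trace_sum_artin_schreier[OF CARD])
  qed

  have "inj f \<longleftrightarrow> (\<forall>x. frobenius_act A x = 0 \<longrightarrow> (x :: 'f) ^ 3 = x)"
  proof
    assume "inj f"
    show "\<forall>x. frobenius_act A x = 0 \<longrightarrow> (x :: 'f) ^ 3 = x"
    proof (intro allI impI)
      fix x :: 'f assume "frobenius_act A x = 0"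
      \<comment> \<open>The element 0 is written as \<open>0 ^ 3 - 0\<close> so that
        \<open>zero\<close> applies to both sides.\<close>
      then have "f (x ^ 3 - x) = f (0 ^ 3 - 0)" unfolding zero by (simp add: frobenius_act_0_right)
      then have "x ^ 3 - x = 0 ^ 3 - 0" using \<open>inj f\<close> by (simp only: inj_eq)
      then show "x ^ 3 = x" by simp
    qed
  next
    assume R: "\<forall>x. frobenius_act A x = 0 \<longrightarrow> (x :: 'f) ^ 3 = x"
    show "inj f"
    proof (rule injI)
      fix y z assume eq: "f y = f z"
      show "y = z"
      proof (cases "trace_sum e y = 0")
        case True
        then have "trace_sum e z = 0" using eq trace_zero twisted(1) by metis
        then obtain v where v: "z = v ^ 3 - v"
          using trace_sum_zero_artin_schreier[OF CARD e] by blast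
        obtain u where u: "y = u ^ 3 - u"
          using trace_sum_zero_artin_schreier[OF CARD e True] ..
        \<comment> \<open>By additivity, equal values mean that the Artin--Schreier roots differ by
          a kernel element; by \<open>R\<close> this lies in the prime field, which
          \<open>x ^ 3 - x\<close> does not see.\<close>
        have "frobenius_act A (u - v) = 0"
          using eq unfolding u v zero by (simp add: frobenius_act_diff_right[OF C])
        then have "(u - v) ^ 3 = u - v" using R by blast
        then have "u ^ 3 - v ^ 3 = u - v" unfolding CHAR_3_cube_diff[OF C] .
        then show ?thesis unfolding u v by (simp add: algebra_simps)
      next
        case False
        then have "trace_sum e z \<noteq> 0" using eq trace_zero twisted(1) by metis
        then show ?thesis using twisted(2) False eq by blast
      qed
    qed
  qed
  moreover have "permutation_poly (map_poly prime_field_emb (g_poly TYPE(F3) n :: F3 poly) :: 'f poly)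
      \<longleftrightarrow> inj f"
    unfolding permutation_poly_def poly_map_g_poly[OF C] bij_def f_def
    using finite_UNIV_inj_surj[of "shift_sum n :: 'f \<Rightarrow> 'f"] by auto
  ultimately show ?thesis
    using gcd_eq_X_minus_1_iff[OF CARD e LA] unfolding A_def by (simp only:)
qed

end
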